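(* Let $R$ be a unital ring and let $M$ be a left $R$-module. Suppose that $M$ has finite Krull-Schmidt length. The following conditions are equivalent: 1. Any two indecomposable direct sum decompositions of $M$ have the same cardinality. 2. The function $KS\ell$ is a rank function on $\mathcal{S}(M)$. 3. The function $KS\ell$ is an additive function on $\mathcal{S}(M)$. Moreover, if $M$ satisfies the conditions above, then for any $N\in\mathcal{S}(M)$, $KS\ell(N)$ is equal to the cardinality of any indecomposable direct sum decomposition of $N$.
   Context: $\mathcal{S}(M)$ denotes the set of all direct summands of $M$. A direct sum decomposition of a module is an internal direct sum decomposition with nonzero summands; its cardinality is the number of summands (the zero module has only the empty decomposition, of cardinality $0$); it is indecomposable if all its summands are indecomposable. The Krull-Schmidt length $KS\ell(N)$ of a module $N$ is the supremum of all cardinalities of direct sum decompositions of $N$. A function $\xi:\mathcal{S}(M)\to\mathbb{N}$ is a rank function if $\xi(A\oplus B)\leq\xi(A)+\xi(B)$, and an additive function if $\xi(A\oplus B)=\xi(A)+\xi(B)$, in each case for all $A,B\in\mathcal{S}(M)$ whose sum in $M$ is direct and satisfies $A\oplus B\in\mathcal{S}(M)$. *)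

theory Defs
  imports
    "HOL-Algebra.Algebra"
    "HOL-Library.Extended_Nat"
    "HOL-Library.Equipollence"
begin

text \<open>
  The locale \<^locale>\<open>module\<close> requires a commutative ring of scalars. The following
  has the same axioms over an arbitrary unital ring. The multiplicative part of the record
  \<open>M\<close> is irrelevant.
\<close>

locale left_module = R?: ring R + M?: abelian_group M
  for R :: "('a, 'r) ring_scheme" (structure) and M :: "('a, 'b, 'm) module_scheme" (structure) +
  assumes smult_closed [simp, intro]:
      "\<lbrakk>a \<in> carrier R; x \<in> carrier M\<rbrakk> \<Longrightarrow> a \<odot>\<^bsub>M\<^esub> x \<in> carrier M"
    and smult_l_distr:
      "\<lbrakk>a \<in> carrier R; b \<in> carrier R; x \<in> carrier M\<rbrakk> \<Longrightarrow>
        (a \<oplus> b) \<odot>\<^bsub>M\<^esub> x = a \<odot>\<^bsub>M\<^esub> x \<oplus>\<^bsub>M\<^esub> b \<odot>\<^bsub>M\<^esub> x"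
    and smult_r_distr:
      "\<lbrakk>a \<in> carrier R; x \<in> carrier M; y \<in> carrier M\<rbrakk> \<Longrightarrow>
        a \<odot>\<^bsub>M\<^esub> (x \<oplus>\<^bsub>M\<^esub> y) = a \<odot>\<^bsub>M\<^esub> x \<oplus>\<^bsub>M\<^esub> a \<odot>\<^bsub>M\<^esub> y"
    and smult_assoc:
      "\<lbrakk>a \<in> carrier R; b \<in> carrier R; x \<in> carrier M\<rbrakk> \<Longrightarrow>
        (a \<otimes> b) \<odot>\<^bsub>M\<^esub> x = a \<odot>\<^bsub>M\<^esub> (b \<odot>\<^bsub>M\<^esub> x)"
    and smult_one [simp]:
      "x \<in> carrier M \<Longrightarrow> \<one> \<odot>\<^bsub>M\<^esub> x = x"

text \<open>
  A submodule \<open>N\<close> of \<open>M\<close>, regarded as a module in its own right.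
\<close>

abbreviation sub_mod :: "('a, 'b, 'm) module_scheme \<Rightarrow> 'b set \<Rightarrow> ('a, 'b, 'm) module_scheme"
  where "sub_mod M N \<equiv> M\<lparr>carrier := N\<rparr>"

definition direct_summands ::
    "('a, 'r) ring_scheme \<Rightarrow> ('a, 'b, 'm) module_scheme \<Rightarrow> 'b set set"
  where "direct_summands R M =
    {A. submodule A R M \<and>
        (\<exists>B. submodule B R M \<and> A \<inter> B = {\<zero>\<^bsub>M\<^esub>} \<and> A <+>\<^bsub>M\<^esub> B = carrier M)}"

definition indecomposable_module ::
    "('a, 'r) ring_scheme \<Rightarrow> ('a, 'b, 'm) module_scheme \<Rightarrow> bool"
  where "indecomposable_module R M \<longleftrightarrow>
    carrier M \<noteq> {\<zero>\<^bsub>M\<^esub>} \<and>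
    (\<forall>A B. submodule A R M \<and> submodule B R M \<and>
           A \<inter> B = {\<zero>\<^bsub>M\<^esub>} \<and> A <+>\<^bsub>M\<^esub> B = carrier M
           \<longrightarrow> A = {\<zero>\<^bsub>M\<^esub>} \<or> B = {\<zero>\<^bsub>M\<^esub>})"

text \<open>
  \<open>M\<close> is the internal direct sum of the (possibly infinite) family \<open>D\<close> of submodules: the
  canonical map from the external direct sum (\<^const>\<open>sum_group\<close>: families with finite support) to
  \<open>M\<close>, sending a family to the sum of its members, is a bijection. Since the summands are nonzero,
  distinct summands are different as sets, so that a set \<open>D\<close> (rather than an indexed family) is
  enough. For \<open>D = {}\<close> the external direct sum has exactly one element.
\<close>

definition direct_sum_decomposition ::
    "('a, 'r) ring_scheme \<Rightarrow> ('a, 'b, 'm) module_scheme \<Rightarrow> 'b set set \<Rightarrow> bool"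
  where "direct_sum_decomposition R M D \<longleftrightarrow>
    (\<forall>A\<in>D. submodule A R M \<and> A \<noteq> {\<zero>\<^bsub>M\<^esub>}) \<and>
    bij_betw (\<lambda>x. gfinprod (add_monoid M) x D)
      (carrier (sum_group D (\<lambda>A. add_monoid (sub_mod M A))))
      (carrier M)"

definition indecomposable_decomposition ::
    "('a, 'r) ring_scheme \<Rightarrow> ('a, 'b, 'm) module_scheme \<Rightarrow> 'b set set \<Rightarrow> bool"
  where "indecomposable_decomposition R M D \<longleftrightarrow>
    direct_sum_decomposition R M D \<and> (\<forall>A\<in>D. indecomposable_module R (sub_mod M A))"

text \<open>
  Cardinality with values in \<^typ>\<open>enat\<close>; unlike \<^const>\<open>card\<close> it does not send infinite sets to 0.
\<close>

definition ecard :: "'c set \<Rightarrow> enat"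
  where "ecard A = (if finite A then enat (card A) else \<infinity>)"

definition KS_length ::
    "('a, 'r) ring_scheme \<Rightarrow> ('a, 'b, 'm) module_scheme \<Rightarrow> enat"
  where "KS_length R M = (SUP D \<in> {D. direct_sum_decomposition R M D}. ecard D)"

text \<open>
  Rank functions and additive functions take values in the natural numbers. As
  \<^const>\<open>KS_length\<close> is a priori \<^typ>\<open>enat\<close>-valued, finiteness of the values on the direct summands
  is part of the definitions.
\<close>

definition rank_function ::
    "('a, 'r) ring_scheme \<Rightarrow> ('a, 'b, 'm) module_scheme \<Rightarrow> ('b set \<Rightarrow> enat) \<Rightarrow> bool"
  where "rank_function R M \<xi> \<longleftrightarrow>
    \<xi> \<in> direct_summands R M \<rightarrow> range enat \<and>
    (\<forall>A \<in> direct_summands R M. \<forall>B \<in> direct_summands R M.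
       A \<inter> B = {\<zero>\<^bsub>M\<^esub>} \<and> A <+>\<^bsub>M\<^esub> B \<in> direct_summands R M
       \<longrightarrow> \<xi> (A <+>\<^bsub>M\<^esub> B) \<le> \<xi> A + \<xi> B)"

definition additive_function ::
    "('a, 'r) ring_scheme \<Rightarrow> ('a, 'b, 'm) module_scheme \<Rightarrow> ('b set \<Rightarrow> enat) \<Rightarrow> bool"
  where "additive_function R M \<xi> \<longleftrightarrow>
    \<xi> \<in> direct_summands R M \<rightarrow> range enat \<and>
    (\<forall>A \<in> direct_summands R M. \<forall>B \<in> direct_summands R M.
       A \<inter> B = {\<zero>\<^bsub>M\<^esub>} \<and> A <+>\<^bsub>M\<^esub> B \<in> direct_summands R M
       \<longrightarrow> \<xi> (A <+>\<^bsub>M\<^esub> B) = \<xi> A + \<xi> B)"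

end

theory Submission
  imports Defs
begin

text \<open>
  Write \<open>\<ell>(N)\<close> for the Krull-Schmidt length \<open>KSl N\<close> of a submodule \<open>N\<close> of \<open>M\<close>. Everything rests on two
  ways of handling decompositions: decompositions of \<open>A\<close> and of \<open>B\<close> together form one of
  \<open>A \<oplus> B\<close> (\<open>independent_Un\<close>), and removing a summand \<open>A\<close> from a decomposition of \<open>N\<close> leaves a
  decomposition of a complement of \<open>A\<close> in \<open>N\<close> (\<open>independent_remove\<close>).

  The first makes \<open>\<ell>\<close> superadditive: \<open>\<ell>(A) + \<ell>(B) \<le> \<ell>(A \<oplus> B)\<close>. So \<open>\<ell>\<close> is
  at most \<open>\<ell>(M) < \<infinity>\<close> on direct summands, and a rank function, which is subadditive, is already
  additive. A finite length is attained, and a decomposition that attains it is indecomposable, as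
  splitting one of its summands would give a longer one. Hence every direct summand \<open>N\<close> has an
  indecomposable decomposition of cardinality exactly \<open>\<ell>(N)\<close>.

  Suppose that the indecomposable decompositions of \<open>M\<close> all have the same cardinality, and let
  \<open>M = N \<oplus> N'\<close>. Extending two indecomposable decompositions of \<open>N\<close> by the same indecomposable
  decomposition of \<open>N'\<close>, which has finite cardinality, gives two of \<open>M\<close>; cancelling, the two
  decompositions of \<open>N\<close> have the same cardinality. One of them may be taken of cardinality
  \<open>\<ell>(N)\<close>, which gives the last claim of the theorem. Additivity follows: decompositions that attain
  \<open>\<ell>(A)\<close> and \<open>\<ell>(B)\<close> form an indecomposable decomposition of \<open>A \<oplus> B\<close>, whose cardinality
  \<open>\<ell>(A) + \<ell>(B)\<close> must therefore be \<open>\<ell>(A \<oplus> B)\<close>.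

  Conversely, let \<open>\<ell>\<close> be a rank function and let \<open>D\<close> be an indecomposable decomposition of \<open>M\<close>.
  Since indecomposable modules have length at most 1, removing the summands one by one shows that
  \<open>\<ell>(M)\<close> is at most the cardinality of \<open>D\<close>. As \<open>D\<close> is one of the decompositions over which the
  supremum \<open>\<ell>(M)\<close> is taken, its cardinality is \<open>\<ell>(M)\<close>.
\<close>

section \<open>Extended natural numbers as cardinalities\<close>

lemma Sup_enat_attained:
  fixes S :: "enat set"
  assumes "S \<noteq> {}" and "Sup S < \<infinity>"
  shows "Sup S \<in> S"
proof -
  have "finite S"
    using assms by (auto simp: Sup_enat_def split: if_splits)
  then show ?thesis
    using Max_in[of S] assms(1) by (simp add: Sup_enat_def)
qed

lemma ecard_Un_disjoint: "A \<inter> B = {} \<Longrightarrow> ecard (A \<union> B) = ecard A + ecard B"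
  by (simp add: ecard_def card_Un_disjoint)

lemma ecard_eq_0_iff: "ecard A = 0 \<longleftrightarrow> A = {}"
  by (auto simp: ecard_def zero_enat_def)

context left_module
begin

section \<open>Submodules\<close>

lemma submoduleI:
  assumes "H \<subseteq> carrier M" and "\<zero>\<^bsub>M\<^esub> \<in> H"
    and "\<And>a b. \<lbrakk>a \<in> H; b \<in> H\<rbrakk> \<Longrightarrow> a \<oplus>\<^bsub>M\<^esub> b \<in> H"
    and "\<And>a. a \<in> H \<Longrightarrow> \<ominus>\<^bsub>M\<^esub> a \<in> H"
    and "\<And>r a. \<lbrakk>r \<in> carrier R; a \<in> H\<rbrakk> \<Longrightarrow> r \<odot>\<^bsub>M\<^esub> a \<in> H"
  shows "submodule H R M"
  using assms
  by (intro submodule.intro subgroup.intro submodule_axioms.intro) (simp_all add: a_inv_def)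

lemma submoduleD:
  assumes "submodule H R M"
  shows "H \<subseteq> carrier M" and "\<zero>\<^bsub>M\<^esub> \<in> H"
    and "\<And>a b. \<lbrakk>a \<in> H; b \<in> H\<rbrakk> \<Longrightarrow> a \<oplus>\<^bsub>M\<^esub> b \<in> H"
    and "\<And>a. a \<in> H \<Longrightarrow> \<ominus>\<^bsub>M\<^esub> a \<in> H"
    and "\<And>r a. \<lbrakk>r \<in> carrier R; a \<in> H\<rbrakk> \<Longrightarrow> r \<odot>\<^bsub>M\<^esub> a \<in> H"
proof -
  interpret submodule H R M by fact
  show "H \<subseteq> carrier M" "\<zero>\<^bsub>M\<^esub> \<in> H"
    "\<And>a b. \<lbrakk>a \<in> H; b \<in> H\<rbrakk> \<Longrightarrow> a \<oplus>\<^bsub>M\<^esub> b \<in> H"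
    "\<And>a. a \<in> H \<Longrightarrow> \<ominus>\<^bsub>M\<^esub> a \<in> H"
    "\<And>r a. \<lbrakk>r \<in> carrier R; a \<in> H\<rbrakk> \<Longrightarrow> r \<odot>\<^bsub>M\<^esub> a \<in> H"
    using subset one_closed m_closed m_inv_closed smult_closed by (auto simp: a_inv_def)
qed

lemma submodule_carrier: "submodule (carrier M) R M"
  by (rule submoduleI) auto

lemma smult_zero: "r \<in> carrier R \<Longrightarrow> r \<odot>\<^bsub>M\<^esub> \<zero>\<^bsub>M\<^esub> = \<zero>\<^bsub>M\<^esub>"
  by (metis M.add.l_cancel_one smult_closed smult_r_distr M.zero_closed M.l_zero)

lemma submodule_zero: "submodule {\<zero>\<^bsub>M\<^esub>} R M"
  by (rule submoduleI) (auto simp: smult_zero)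

lemma submodule_sub_mod_iff:
  assumes "submodule N R M"
  shows "submodule A R (sub_mod M N) \<longleftrightarrow> submodule A R M \<and> A \<subseteq> N"
proof -
  have "subgroup N (add_monoid M)"
    using assms by (rule submodule.axioms)
  then have "subgroup A (add_monoid (sub_mod M N)) \<longleftrightarrow> subgroup A (add_monoid M) \<and> A \<subseteq> N"
    using M.add.incl_subgroup[of N A] M.add.subgroup_incl[of A N] subgroup.subset
    by fastforce
  then show ?thesis
    by (simp add: submodule_def submodule_axioms_def) blast
qed

lemma set_add_mem_iff: "x \<in> A <+>\<^bsub>M\<^esub> B \<longleftrightarrow> (\<exists>a\<in>A. \<exists>b\<in>B. x = a \<oplus>\<^bsub>M\<^esub> b)"
  by (auto simp: set_add_def')

lemma set_add_comm:
  assumes "submodule A R M" and "submodule B R M"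
  shows "A <+>\<^bsub>M\<^esub> B = B <+>\<^bsub>M\<^esub> A"
proof -
  have "a \<oplus>\<^bsub>M\<^esub> b = b \<oplus>\<^bsub>M\<^esub> a" if "a \<in> A" "b \<in> B" for a b
    using that submoduleD(1)[OF assms(1)] submoduleD(1)[OF assms(2)] by (intro M.a_comm) auto
  then show ?thesis
    by (auto simp: set_add_mem_iff) metis+
qed

lemma set_add_sub_mod: "A <+>\<^bsub>sub_mod M N\<^esub> B = A <+>\<^bsub>M\<^esub> B"
  by (simp add: set_add_def')

lemma set_add_upper:
  assumes "submodule A R M" and "submodule B R M"
  shows "A \<subseteq> A <+>\<^bsub>M\<^esub> B" and "B \<subseteq> A <+>\<^bsub>M\<^esub> B"
proof -
  have "a = a \<oplus>\<^bsub>M\<^esub> \<zero>\<^bsub>M\<^esub>" if "a \<in> A" for a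
    using that submoduleD(1)[OF assms(1)] by auto
  then show "A \<subseteq> A <+>\<^bsub>M\<^esub> B"
    using submoduleD(2)[OF assms(2)] unfolding set_add_mem_iff subset_iff by blast
  have "b = \<zero>\<^bsub>M\<^esub> \<oplus>\<^bsub>M\<^esub> b" if "b \<in> B" for b
    using that submoduleD(1)[OF assms(2)] by auto
  then show "B \<subseteq> A <+>\<^bsub>M\<^esub> B"
    using submoduleD(2)[OF assms(1)] unfolding set_add_mem_iff subset_iff by blast
qed

lemma submodule_set_add:
  assumes A: "submodule A R M" and B: "submodule B R M"
  shows "submodule (A <+>\<^bsub>M\<^esub> B) R M"
proof -
  note a = submoduleD[OF A] and b = submoduleD[OF B]
  show ?thesis
  proof (rule submoduleI)
    show "A <+>\<^bsub>M\<^esub> B \<subseteq> carrier M"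
      using a(1) b(1) by (auto simp: set_add_mem_iff subset_iff)
    show "\<zero>\<^bsub>M\<^esub> \<in> A <+>\<^bsub>M\<^esub> B"
      using set_add_upper[OF A B] a(2) by blast
  next
    fix x y assume "x \<in> A <+>\<^bsub>M\<^esub> B" "y \<in> A <+>\<^bsub>M\<^esub> B"
    then obtain p q p' q' where *: "p \<in> A" "q \<in> B" "p' \<in> A" "q' \<in> B"
      and xy: "x = p \<oplus>\<^bsub>M\<^esub> q" "y = p' \<oplus>\<^bsub>M\<^esub> q'"
      by (auto simp: set_add_mem_iff)
    have "x \<oplus>\<^bsub>M\<^esub> y = (p \<oplus>\<^bsub>M\<^esub> p') \<oplus>\<^bsub>M\<^esub> (q \<oplus>\<^bsub>M\<^esub> q')"
      unfolding xy using * a(1) b(1) by (simp add: M.a_ac subset_iff)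
    then show "x \<oplus>\<^bsub>M\<^esub> y \<in> A <+>\<^bsub>M\<^esub> B"
      using * a(3) b(3) unfolding set_add_mem_iff by blast
  next
    fix x assume "x \<in> A <+>\<^bsub>M\<^esub> B"
    then obtain p q where *: "p \<in> A" "q \<in> B" "x = p \<oplus>\<^bsub>M\<^esub> q"
      by (auto simp: set_add_mem_iff)
    then have "\<ominus>\<^bsub>M\<^esub> x = \<ominus>\<^bsub>M\<^esub> p \<oplus>\<^bsub>M\<^esub> \<ominus>\<^bsub>M\<^esub> q"
      using a(1) b(1) by (simp add: M.minus_add subset_iff)
    then show "\<ominus>\<^bsub>M\<^esub> x \<in> A <+>\<^bsub>M\<^esub> B"
      using * a(4) b(4) unfolding set_add_mem_iff by blast
  next
    fix r x assume r: "r \<in> carrier R" and "x \<in> A <+>\<^bsub>M\<^esub> B"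
    then obtain p q where *: "p \<in> A" "q \<in> B" "x = p \<oplus>\<^bsub>M\<^esub> q"
      by (auto simp: set_add_mem_iff)
    then have "r \<odot>\<^bsub>M\<^esub> x = r \<odot>\<^bsub>M\<^esub> p \<oplus>\<^bsub>M\<^esub> r \<odot>\<^bsub>M\<^esub> q"
      using a(1) b(1) r by (auto simp: smult_r_distr subset_iff)
    then show "r \<odot>\<^bsub>M\<^esub> x \<in> A <+>\<^bsub>M\<^esub> B"
      using * a(5) b(5) r unfolding set_add_mem_iff by blast
  qed
qed

text \<open>
  If \<open>N \<oplus> N' = M\<close> and \<open>A \<oplus> B = N\<close>, then \<open>B \<oplus> N'\<close> is a complement of \<open>A\<close> in \<open>M\<close>: if
  \<open>a = b + n'\<close>, then \<open>n' = - b + a\<close> lies in \<open>N \<inter> N'\<close>, so it vanishes, and \<open>a = b\<close> lies in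
  \<open>A \<inter> B\<close>.
\<close>

lemma direct_summands_trans:
  assumes N: "N \<in> direct_summands R M"
    and A: "submodule A R M" and B: "submodule B R M"
    and AB: "A \<inter> B = {\<zero>\<^bsub>M\<^esub>}" and sum: "A <+>\<^bsub>M\<^esub> B = N"
  shows "A \<in> direct_summands R M"
proof -
  obtain N' where sN: "submodule N R M" and N': "submodule N' R M" "N \<inter> N' = {\<zero>\<^bsub>M\<^esub>}" "N <+>\<^bsub>M\<^esub> N' = carrier M"
    using N by (auto simp: direct_summands_def)
  note a = submoduleD[OF A] and b = submoduleD[OF B] and n = submoduleD[OF sN] and n' = submoduleD[OF N'(1)]
  have AN: "A \<subseteq> N" and BN: "B \<subseteq> N"
    using set_add_upper[OF A B] sum by auto
  have "A \<inter> (B <+>\<^bsub>M\<^esub> N') = {\<zero>\<^bsub>M\<^esub>}"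
  proof -
    have "x = \<zero>\<^bsub>M\<^esub>" if x: "x \<in> A" "x \<in> B <+>\<^bsub>M\<^esub> N'" for x
    proof -
      obtain q m where q: "q \<in> B" "m \<in> N'" "x = q \<oplus>\<^bsub>M\<^esub> m"
        using x by (auto simp: set_add_mem_iff)
      have "m = \<ominus>\<^bsub>M\<^esub> q \<oplus>\<^bsub>M\<^esub> x"
        using q b(1) n'(1) by (auto simp: M.r_neg1 subset_iff)
      then have "m \<in> N"
        using n(3)[of "\<ominus>\<^bsub>M\<^esub> q" x] n(4)[of q] AN BN q(1) x(1) by blast
      then have "m = \<zero>\<^bsub>M\<^esub>" using N'(2) q by blast
      then have "x = q" using q b(1) by auto
      then show ?thesis using AB q x by blast
    qed
    then show ?thesis
      using a(2) submoduleD(2)[OF submodule_set_add[OF B N'(1)]] by blast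
  qed
  moreover have "A <+>\<^bsub>M\<^esub> (B <+>\<^bsub>M\<^esub> N') = carrier M"
    unfolding N'(3)[symmetric] sum[symmetric]
    using M.add.set_mult_assoc[OF a(1) b(1) n'(1)] by (simp add: set_add_def)
  ultimately show ?thesis
    using A submodule_set_add[OF B N'(1)] by (auto simp: direct_summands_def)
qed

section \<open>Independent families of submodules and their sums\<close>

text \<open>
  These are the elements of the external direct sum of the members of \<open>D\<close>, except that their values
  outside \<open>D\<close> are arbitrary. One function then represents elements of the external direct sums of
  several sets of submodules, so that passing to a subset of \<open>D\<close> does not change it.
\<close>

definition families :: "'b set set \<Rightarrow> ('b set \<Rightarrow> 'b) set"
  where "families D = {x. (\<forall>A\<in>D. x A \<in> A) \<and> finite {A \<in> D. x A \<noteq> \<zero>\<^bsub>M\<^esub>}}"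

abbreviation family_sum :: "('b set \<Rightarrow> 'b) \<Rightarrow> 'b set set \<Rightarrow> 'b"
  where "family_sum x D \<equiv> gfinprod (add_monoid M) x D"

definition span :: "'b set set \<Rightarrow> 'b set"
  where "span D = (\<lambda>x. family_sum x D) ` families D"

definition submodules :: "'b set set \<Rightarrow> bool"
  where "submodules D \<longleftrightarrow> (\<forall>A\<in>D. submodule A R M)"

text \<open>
  Injectivity of the map from the external direct sum to \<open>M\<close>, in the form of a trivial kernel.
\<close>

definition independent :: "'b set set \<Rightarrow> bool"
  where "independent D \<longleftrightarrow>
    (\<forall>A\<in>D. submodule A R M \<and> A \<noteq> {\<zero>\<^bsub>M\<^esub>}) \<and>
    (\<forall>x\<in>families D. family_sum x D = \<zero>\<^bsub>M\<^esub> \<longrightarrow> (\<forall>A\<in>D. x A = \<zero>\<^bsub>M\<^esub>))"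

lemma submodules_Un: "submodules (D \<union> E) \<longleftrightarrow> submodules D \<and> submodules E"
  by (auto simp: submodules_def)

lemma independent_imp_submodules: "independent D \<Longrightarrow> submodules D"
  by (simp add: independent_def submodules_def)

lemma independentD:
  assumes "independent D" and "x \<in> families D" and "family_sum x D = \<zero>\<^bsub>M\<^esub>"
  shows "\<forall>A\<in>D. x A = \<zero>\<^bsub>M\<^esub>"
  using assms unfolding independent_def by blast

lemma families_carrier:
  assumes "submodules D" and "x \<in> families D"
  shows "x \<in> D \<rightarrow> carrier M"
  using assms submoduleD(1) by (fastforce simp: submodules_def families_def)

lemma family_sum_empty: "family_sum x {} = \<zero>\<^bsub>M\<^esub>"
  by (simp add: gfinprod_def flip: finsum_def)

lemma family_sum_zero: "family_sum (\<lambda>_. \<zero>\<^bsub>M\<^esub>) D = \<zero>\<^bsub>M\<^esub>"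
  using family_sum_empty[of "\<lambda>_. \<zero>\<^bsub>M\<^esub>"] by (simp add: gfinprod_def)

lemma families_zero:
  assumes "submodules D"
  shows "(\<lambda>_. \<zero>\<^bsub>M\<^esub>) \<in> families D"
  using assms submoduleD(2) by (auto simp: submodules_def families_def)

lemma families_add:
  assumes D: "submodules D" and x: "x \<in> families D" and y: "y \<in> families D"
  shows "(\<lambda>A. x A \<oplus>\<^bsub>M\<^esub> y A) \<in> families D"
    and "family_sum (\<lambda>A. x A \<oplus>\<^bsub>M\<^esub> y A) D = family_sum x D \<oplus>\<^bsub>M\<^esub> family_sum y D"
proof -
  have fin: "finite {A \<in> D. x A \<noteq> \<zero>\<^bsub>M\<^esub>}" "finite {A \<in> D. y A \<noteq> \<zero>\<^bsub>M\<^esub>}"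
    using x y by (auto simp: families_def)
  have "finite {A \<in> D. x A \<oplus>\<^bsub>M\<^esub> y A \<noteq> \<zero>\<^bsub>M\<^esub>}"
    by (rule finite_subset[OF _ finite_UnI[OF fin]]) auto
  then show "(\<lambda>A. x A \<oplus>\<^bsub>M\<^esub> y A) \<in> families D"
    using D x y submoduleD(3) by (auto simp: submodules_def families_def)
  show "family_sum (\<lambda>A. x A \<oplus>\<^bsub>M\<^esub> y A) D = family_sum x D \<oplus>\<^bsub>M\<^esub> family_sum y D"
    using M.add.gfinprod_distrib[of D x y] fin families_carrier[OF D x] families_carrier[OF D y]
    by simp
qed

lemma families_minus:
  assumes D: "submodules D" and x: "x \<in> families D"
  shows "(\<lambda>A. \<ominus>\<^bsub>M\<^esub> x A) \<in> families D"
    and "family_sum (\<lambda>A. \<ominus>\<^bsub>M\<^esub> x A) D = \<ominus>\<^bsub>M\<^esub> family_sum x D"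
proof -
  note car = families_carrier[OF D x]
  have fin: "finite {A \<in> D. x A \<noteq> \<zero>\<^bsub>M\<^esub>}"
    using x by (auto simp: families_def)
  have "finite {A \<in> D. \<ominus>\<^bsub>M\<^esub> x A \<noteq> \<zero>\<^bsub>M\<^esub>}"
    by (rule finite_subset[OF _ fin]) auto
  then show mem: "(\<lambda>A. \<ominus>\<^bsub>M\<^esub> x A) \<in> families D"
    using D x submoduleD(4) by (auto simp: submodules_def families_def)
  have "family_sum (\<lambda>A. \<ominus>\<^bsub>M\<^esub> x A) D \<oplus>\<^bsub>M\<^esub> family_sum x D = family_sum (\<lambda>A. \<ominus>\<^bsub>M\<^esub> x A \<oplus>\<^bsub>M\<^esub> x A) D"
    by (rule families_add(2)[OF D mem x, symmetric])
  also have "\<dots> = family_sum (\<lambda>_. \<zero>\<^bsub>M\<^esub>) D"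
    using car by (intro M.add.gfinprod_cong) (auto simp: M.l_neg simp_implies_def Pi_iff)
  finally have "family_sum (\<lambda>A. \<ominus>\<^bsub>M\<^esub> x A) D \<oplus>\<^bsub>M\<^esub> family_sum x D = \<zero>\<^bsub>M\<^esub>"
    by (simp add: family_sum_zero)
  then show "family_sum (\<lambda>A. \<ominus>\<^bsub>M\<^esub> x A) D = \<ominus>\<^bsub>M\<^esub> family_sum x D"
    using M.minus_equality M.add.gfinprod_closed[of _ D] car families_carrier[OF D mem] by auto
qed

lemma families_smult:
  assumes D: "submodules D" and x: "x \<in> families D" and r: "r \<in> carrier R"
  shows "(\<lambda>A. r \<odot>\<^bsub>M\<^esub> x A) \<in> families D"
    and "family_sum (\<lambda>A. r \<odot>\<^bsub>M\<^esub> x A) D = r \<odot>\<^bsub>M\<^esub> family_sum x D"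
proof -
  note car = families_carrier[OF D x]
  let ?S = "{A \<in> D. x A \<noteq> \<zero>\<^bsub>M\<^esub>}"
  have fin: "finite ?S"
    using x by (auto simp: families_def)
  have sub: "{A \<in> D. r \<odot>\<^bsub>M\<^esub> x A \<noteq> \<zero>\<^bsub>M\<^esub>} \<subseteq> ?S"
    using r by (auto simp: smult_zero)
  then show "(\<lambda>A. r \<odot>\<^bsub>M\<^esub> x A) \<in> families D"
    using finite_subset[OF sub fin] D x r submoduleD(5) by (auto simp: submodules_def families_def)
  have smult_finite: "family_sum (\<lambda>A. r \<odot>\<^bsub>M\<^esub> x A) F = r \<odot>\<^bsub>M\<^esub> family_sum x F"
    if "finite F" "F \<subseteq> D" for F
    using that
  proof induction
    case empty
    then show ?case using r by (simp add: family_sum_empty smult_zero)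
  next
    case (insert A F)
    have "x A \<in> carrier M" "x \<in> F \<rightarrow> carrier M" "(\<lambda>A. r \<odot>\<^bsub>M\<^esub> x A) \<in> F \<rightarrow> carrier M"
      using insert.prems car r by auto
    then show ?case
      using insert M.add.gfinprod_insert[of F x A] M.add.gfinprod_insert[of F "\<lambda>A. r \<odot>\<^bsub>M\<^esub> x A" A]
        M.add.gfinprod_closed[of x F] r
      by (simp add: smult_r_distr)
  qed
  have "family_sum (\<lambda>A. r \<odot>\<^bsub>M\<^esub> x A) D = family_sum (\<lambda>A. r \<odot>\<^bsub>M\<^esub> x A) ?S"
    by (rule M.add.gfinprod_mono_neutral_cong_right) (use car r in \<open>auto simp: smult_zero\<close>)
  also have "\<dots> = r \<odot>\<^bsub>M\<^esub> family_sum x ?S"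
    by (rule smult_finite[OF fin]) auto
  also have "family_sum x ?S = family_sum x D"
    by (rule M.add.gfinprod_mono_neutral_cong_left) (use car in auto)
  finally show "family_sum (\<lambda>A. r \<odot>\<^bsub>M\<^esub> x A) D = r \<odot>\<^bsub>M\<^esub> family_sum x D" .
qed

lemma family_sum_in_span: "x \<in> families D \<Longrightarrow> family_sum x D \<in> span D"
  by (simp add: span_def)

lemma spanE:
  assumes "a \<in> span D"
  obtains x where "x \<in> families D" and "a = family_sum x D"
  using assms by (auto simp: span_def)

lemma submodule_span:
  assumes D: "submodules D"
  shows "submodule (span D) R M"
proof (rule submoduleI)
  show "span D \<subseteq> carrier M"
  proof
    fix a assume "a \<in> span D"
    then obtain x where "x \<in> families D" "a = family_sum x D"
      by (rule spanE)
    then show "a \<in> carrier M"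
      using M.add.gfinprod_closed[OF families_carrier[OF D]] by simp
  qed
  show "\<zero>\<^bsub>M\<^esub> \<in> span D"
    using family_sum_in_span[OF families_zero[OF D]] by (simp only: family_sum_zero)
next
  fix a b assume "a \<in> span D" "b \<in> span D"
  then obtain x y where x: "x \<in> families D" "a = family_sum x D"
    and y: "y \<in> families D" "b = family_sum y D"
    by (meson spanE)
  show "a \<oplus>\<^bsub>M\<^esub> b \<in> span D"
    unfolding x(2) y(2) families_add(2)[OF D x(1) y(1), symmetric]
    by (rule family_sum_in_span[OF families_add(1)[OF D x(1) y(1)]])
next
  fix a assume "a \<in> span D"
  then obtain x where x: "x \<in> families D" "a = family_sum x D"
    by (rule spanE)
  show "\<ominus>\<^bsub>M\<^esub> a \<in> span D"
    unfolding x(2) families_minus(2)[OF D x(1), symmetric]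
    by (rule family_sum_in_span[OF families_minus(1)[OF D x(1)]])
next
  fix r a assume r: "r \<in> carrier R" and "a \<in> span D"
  then obtain x where x: "x \<in> families D" "a = family_sum x D"
    by (meson spanE)
  show "r \<odot>\<^bsub>M\<^esub> a \<in> span D"
    unfolding x(2) families_smult(2)[OF D x(1) r, symmetric]
    by (rule family_sum_in_span[OF families_smult(1)[OF D x(1) r]])
qed

text \<open>
  The external direct sum over a disjoint union is the product of the two external direct sums. The
  glued family is the pointwise sum of the extensions of \<open>x\<close> and \<open>y\<close> by zero, so that additivity of
  \<open>family_sum\<close> applies.
\<close>

lemma families_glue:
  assumes D: "submodules D" and E: "submodules E" and disj: "D \<inter> E = {}"
    and x: "x \<in> families D" and y: "y \<in> families E"
  defines "z \<equiv> \<lambda>A. if A \<in> D then x A else y A"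
  shows "z \<in> families (D \<union> E)"
    and "family_sum z (D \<union> E) = family_sum x D \<oplus>\<^bsub>M\<^esub> family_sum y E"
proof -
  note cx = families_carrier[OF D x] and cy = families_carrier[OF E y]
  have fx: "finite {A \<in> D. x A \<noteq> \<zero>\<^bsub>M\<^esub>}" and fy: "finite {A \<in> E. y A \<noteq> \<zero>\<^bsub>M\<^esub>}"
    using x y by (auto simp: families_def)
  have supp: "{A \<in> D \<union> E. z A \<noteq> \<zero>\<^bsub>M\<^esub>} = {A \<in> D. x A \<noteq> \<zero>\<^bsub>M\<^esub>} \<union> {A \<in> E. y A \<noteq> \<zero>\<^bsub>M\<^esub>}"
    using disj by (auto simp: z_def)
  show "z \<in> families (D \<union> E)"
    using x y supp fx fy by (auto simp: families_def z_def)
  let ?x = "\<lambda>A. if A \<in> D then x A else \<zero>\<^bsub>M\<^esub>" and ?y = "\<lambda>A. if A \<in> D then \<zero>\<^bsub>M\<^esub> else y A"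
  have fx': "finite {A \<in> D \<union> E. ?x A \<noteq> \<zero>\<^bsub>M\<^esub>}"
    by (rule finite_subset[OF _ fx]) auto
  have fy': "finite {A \<in> D \<union> E. ?y A \<noteq> \<zero>\<^bsub>M\<^esub>}"
    by (rule finite_subset[OF _ fy]) auto
  have cx': "?x \<in> D \<union> E \<rightarrow> carrier M" and cy': "?y \<in> D \<union> E \<rightarrow> carrier M"
    using cx cy by auto
  have "family_sum z (D \<union> E) = family_sum (\<lambda>A. ?x A \<oplus>\<^bsub>M\<^esub> ?y A) (D \<union> E)"
    by (rule M.add.gfinprod_cong) (use cx cy in \<open>auto simp: z_def simp_implies_def Pi_iff\<close>)
  also have "\<dots> = family_sum ?x (D \<union> E) \<oplus>\<^bsub>M\<^esub> family_sum ?y (D \<union> E)"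
    using M.add.gfinprod_distrib[of "D \<union> E" ?x ?y] fx' fy' cx' cy' by simp
  also have "family_sum ?x (D \<union> E) = family_sum x D"
    by (rule M.add.gfinprod_mono_neutral_cong_right) (use cx in auto)
  also have "family_sum ?y (D \<union> E) = family_sum y E"
    by (rule M.add.gfinprod_mono_neutral_cong_right) (use cy disj in auto)
  finally show "family_sum z (D \<union> E) = family_sum x D \<oplus>\<^bsub>M\<^esub> family_sum y E" .
qed

lemma families_restrict:
  assumes "x \<in> families D" and "E \<subseteq> D"
  shows "x \<in> families E"
  using assms finite_subset[of "{A \<in> E. x A \<noteq> \<zero>\<^bsub>M\<^esub>}" "{A \<in> D. x A \<noteq> \<zero>\<^bsub>M\<^esub>}"]
  by (auto simp: families_def)

lemma family_sum_Un:
  assumes D: "submodules D" and E: "submodules E" and disj: "D \<inter> E = {}"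
    and x: "x \<in> families (D \<union> E)"
  shows "family_sum x (D \<union> E) = family_sum x D \<oplus>\<^bsub>M\<^esub> family_sum x E"
  using families_glue(2)[OF D E disj, of x x] families_restrict[OF x] by simp

lemma span_Un:
  assumes D: "submodules D" and E: "submodules E" and disj: "D \<inter> E = {}"
  shows "span (D \<union> E) = span D <+>\<^bsub>M\<^esub> span E"
proof (intro equalityI subsetI)
  fix a assume "a \<in> span (D \<union> E)"
  then obtain x where x: "x \<in> families (D \<union> E)" and a: "a = family_sum x (D \<union> E)"
    by (rule spanE)
  have "a = family_sum x D \<oplus>\<^bsub>M\<^esub> family_sum x E"
    unfolding a by (rule family_sum_Un[OF D E disj x])
  moreover have "family_sum x D \<in> span D" "family_sum x E \<in> span E"
    using families_restrict[OF x] by (auto intro: family_sum_in_span)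
  ultimately show "a \<in> span D <+>\<^bsub>M\<^esub> span E"
    unfolding set_add_mem_iff by blast
next
  fix a assume "a \<in> span D <+>\<^bsub>M\<^esub> span E"
  then obtain b c where "b \<in> span D" "c \<in> span E" and a: "a = b \<oplus>\<^bsub>M\<^esub> c"
    unfolding set_add_mem_iff by blast
  then obtain x y where x: "x \<in> families D" "b = family_sum x D"
    and y: "y \<in> families E" "c = family_sum y E"
    by (meson spanE)
  show "a \<in> span (D \<union> E)"
    unfolding a x(2) y(2) families_glue(2)[OF D E disj x(1) y(1), symmetric]
    by (rule family_sum_in_span[OF families_glue(1)[OF D E disj x(1) y(1)]])
qed

lemma span_empty: "span {} = {\<zero>\<^bsub>M\<^esub>}"
  by (auto simp: span_def families_def family_sum_empty)

lemma independent_empty: "independent {}"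
  by (simp add: independent_def)

lemma family_sum_singleton:
  assumes "submodule A R M" and "x A \<in> A"
  shows "family_sum x {A} = x A"
proof -
  have "x A \<in> carrier M"
    using submoduleD(1)[OF assms(1)] assms(2) by auto
  then show ?thesis
    using M.add.gfinprod_insert[of "{}" x A] by (simp add: family_sum_empty del: M.add.gfinprod_eq_finprod)
qed

lemma span_singleton:
  assumes "submodule A R M"
  shows "span {A} = A"
proof (intro equalityI subsetI)
  fix a assume "a \<in> span {A}"
  then show "a \<in> A"
    using family_sum_singleton[OF assms] by (auto simp: span_def families_def)
next
  fix a assume "a \<in> A"
  then have "(\<lambda>_. a) \<in> families {A}" and eq: "family_sum (\<lambda>_. a) {A} = a"
    using family_sum_singleton[OF assms, of "\<lambda>_. a"] by (auto simp: families_def)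
  from family_sum_in_span[OF this(1)] show "a \<in> span {A}"
    by (simp only: eq)
qed

lemma independent_singleton:
  assumes "submodule A R M" and "A \<noteq> {\<zero>\<^bsub>M\<^esub>}"
  shows "independent {A}"
  using assms family_sum_singleton[OF assms(1)] by (auto simp: independent_def families_def)

lemma mem_subset_span:
  assumes D: "submodules D" and A: "A \<in> D"
  shows "A \<subseteq> span D"
proof -
  have sA: "submodule A R M" and s: "submodules {A}" "submodules (D - {A})"
    using assms by (auto simp: submodules_def)
  have "span D = A <+>\<^bsub>M\<^esub> span (D - {A})"
    using span_Un[OF s] span_singleton[OF sA] A by (simp add: insert_absorb)
  then show ?thesis
    using set_add_upper(1)[OF sA submodule_span[OF s(2)]] by simp
qed

text \<open>
  A vanishing sum over \<open>D \<union> E\<close> is a sum over \<open>D\<close> plus a sum over \<open>E\<close>; each is the negative of the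
  other, so both lie in the intersection of the two spans and vanish. The sets \<open>D\<close> and \<open>E\<close> are
  disjoint because a common member would be contained in that intersection, while all members are
  nonzero.
\<close>

lemma independent_Un:
  assumes D: "independent D" and E: "independent E" and int: "span D \<inter> span E = {\<zero>\<^bsub>M\<^esub>}"
  shows "D \<inter> E = {}" and "independent (D \<union> E)" and "span (D \<union> E) = span D <+>\<^bsub>M\<^esub> span E"
proof -
  note sD = independent_imp_submodules[OF D] and sE = independent_imp_submodules[OF E]
  have "A = {\<zero>\<^bsub>M\<^esub>}" if "A \<in> D" "A \<in> E" for A
    using mem_subset_span[OF sD that(1)] mem_subset_span[OF sE that(2)] int
      submoduleD(2)[of A] sD that(1) by (auto simp: submodules_def)
  then show disj: "D \<inter> E = {}"
    using D by (auto simp: independent_def)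
  show "span (D \<union> E) = span D <+>\<^bsub>M\<^esub> span E"
    by (rule span_Un[OF sD sE disj])
  have "\<forall>A\<in>D \<union> E. x A = \<zero>\<^bsub>M\<^esub>" if x: "x \<in> families (D \<union> E)" and tot: "family_sum x (D \<union> E) = \<zero>\<^bsub>M\<^esub>" for x
  proof -
    have xD: "x \<in> families D" and xE: "x \<in> families E"
      using families_restrict[OF x] by auto
    have c: "family_sum x D \<in> span D" "family_sum x E \<in> span E"
      using xD xE by (auto simp: span_def)
    note mD = submoduleD[OF submodule_span[OF sD]] and mE = submoduleD[OF submodule_span[OF sE]]
    have eq: "family_sum x D \<oplus>\<^bsub>M\<^esub> family_sum x E = \<zero>\<^bsub>M\<^esub>"
      using tot family_sum_Un[OF sD sE disj x] by simp
    have "\<ominus>\<^bsub>M\<^esub> family_sum x E = family_sum x D"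
      using eq c mD(1) mE(1) by (intro M.minus_equality) auto
    then have 0: "family_sum x D = \<zero>\<^bsub>M\<^esub>"
      using c mE(4)[of "family_sum x E"] int by auto
    then have "family_sum x E = \<zero>\<^bsub>M\<^esub>"
      using eq c mE(1) by auto
    with 0 show ?thesis
      using D E xD xE by (auto simp: independent_def)
  qed
  then show "independent (D \<union> E)"
    using D E by (auto simp: independent_def)
qed

text \<open>
  For an element with representations \<open>x\<close> over \<open>D\<close> and \<open>y\<close> over \<open>E\<close>, the family equal to \<open>x\<close> on
  \<open>D\<close> and to \<open>- y\<close> on \<open>E\<close> has sum zero, so it vanishes by independence of \<open>D \<union> E\<close>.
\<close>

lemma independent_split:
  assumes DE: "independent (D \<union> E)" and disj: "D \<inter> E = {}"
  shows "independent D" and "span D \<inter> span E = {\<zero>\<^bsub>M\<^esub>}"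
proof -
  have sD: "submodules D" and sE: "submodules E"
    using independent_imp_submodules[OF DE] by (auto simp: submodules_Un)
  have key: "\<forall>A\<in>D. x A = \<zero>\<^bsub>M\<^esub>"
    if "x \<in> families D" "y \<in> families E" "family_sum x D \<oplus>\<^bsub>M\<^esub> family_sum y E = \<zero>\<^bsub>M\<^esub>" for x y
  proof -
    note glue = families_glue[OF sD sE disj that(1,2)]
    have "\<forall>A\<in>D \<union> E. (if A \<in> D then x A else y A) = \<zero>\<^bsub>M\<^esub>"
      by (rule independentD[OF DE glue(1)]) (simp only: glue(2) that(3))
    then show ?thesis by (metis UnI1)
  qed
  have "\<forall>A\<in>D. x A = \<zero>\<^bsub>M\<^esub>" if "x \<in> families D" "family_sum x D = \<zero>\<^bsub>M\<^esub>" for x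
    using key[OF that(1) families_zero[OF sE]] that(2) by (simp add: family_sum_zero)
  then show "independent D"
    using DE by (auto simp: independent_def)
  have "a = \<zero>\<^bsub>M\<^esub>" if aD: "a \<in> span D" and aE: "a \<in> span E" for a
  proof -
    obtain x where x: "x \<in> families D" "a = family_sum x D"
      using aD by (rule spanE)
    obtain y where y: "y \<in> families E" "a = family_sum y E"
      using aE by (rule spanE)
    have "a \<in> carrier M"
      using aD submoduleD(1)[OF submodule_span[OF sD]] by auto
    then have "family_sum x D \<oplus>\<^bsub>M\<^esub> family_sum (\<lambda>A. \<ominus>\<^bsub>M\<^esub> y A) E = \<zero>\<^bsub>M\<^esub>"
      unfolding families_minus(2)[OF sE y(1)] x(2)[symmetric] y(2)[symmetric] by (rule M.r_neg)
    then have "\<forall>A\<in>D. x A = \<zero>\<^bsub>M\<^esub>"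
      by (rule key[OF x(1) families_minus(1)[OF sE y(1)]])
    then have "family_sum x D = family_sum (\<lambda>_. \<zero>\<^bsub>M\<^esub>) D"
      by (intro M.add.gfinprod_cong) (auto simp: simp_implies_def)
    then show ?thesis
      by (simp add: x(2) family_sum_zero)
  qed
  then show "span D \<inter> span E = {\<zero>\<^bsub>M\<^esub>}"
    using submoduleD(2)[OF submodule_span[OF sD]] submoduleD(2)[OF submodule_span[OF sE]] by blast
qed

lemma independent_remove:
  assumes D: "independent D" and A: "A \<in> D"
  shows "independent (D - {A})" and "A \<inter> span (D - {A}) = {\<zero>\<^bsub>M\<^esub>}"
    and "A <+>\<^bsub>M\<^esub> span (D - {A}) = span D"
proof -
  have sA: "submodule A R M" and s: "submodules {A}" "submodules (D - {A})"
    using assms by (auto simp: submodules_def independent_def)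
  have un: "{A} \<union> (D - {A}) = D" "(D - {A}) \<union> {A} = D" using A by auto
  show "independent (D - {A})"
    by (rule independent_split(1)[of _ "{A}"]) (use un D in auto)
  show "A \<inter> span (D - {A}) = {\<zero>\<^bsub>M\<^esub>}"
    using independent_split(2)[of "{A}" "D - {A}"] D un span_singleton[OF sA] by auto
  show "A <+>\<^bsub>M\<^esub> span (D - {A}) = span D"
    using span_Un[OF s] un span_singleton[OF sA] by auto
qed

section \<open>Decompositions of a submodule\<close>

text \<open>
  Since \<open>gfinprod\<close> refers to the carrier of its monoid, the sum computed in a submodule has to be
  compared with the sum computed in \<open>M\<close>; on finite sets this is an induction.
\<close>

lemma gfinprod_sub_mod:
  assumes N: "submodule N R M" and x: "x \<in> D \<rightarrow> N"
  shows "gfinprod (add_monoid (sub_mod M N)) x D = family_sum x D"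
proof -
  have "group (add_monoid (sub_mod M N))"
    using subgroup.subgroup_is_group[OF submodule.axioms(1)[OF N] M.add.group_axioms] by simp
  then interpret N: comm_group "add_monoid (sub_mod M N)"
    using submoduleD(1)[OF N]
    by (intro group.group_comm_groupI) (auto intro!: M.a_comm)
  have car: "x \<in> D \<rightarrow> carrier M"
    using x submoduleD(1)[OF N] by auto
  have fin: "gfinprod (add_monoid (sub_mod M N)) x F = family_sum x F" if "finite F" "F \<subseteq> D" for F
    using that
  proof induction
    case empty
    then show ?case by (simp only: family_sum_empty) (simp add: gfinprod_def N.finprod_empty[simplified])
  next
    case (insert A F)
    have "x A \<in> N" "x \<in> F \<rightarrow> N" "x A \<in> carrier M" "x \<in> F \<rightarrow> carrier M"
      using insert.prems x car by auto
    then show ?case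
      using insert M.add.gfinprod_insert[of F x A] N.gfinprod_insert[of F x A]
      by simp
  qed
  let ?S = "{A \<in> D. x A \<noteq> \<zero>\<^bsub>M\<^esub>}"
  have "gfinprod (add_monoid (sub_mod M N)) x D = gfinprod (add_monoid (sub_mod M N)) x ?S"
    by (rule N.gfinprod_mono_neutral_cong_right) (use x in auto)
  moreover have "family_sum x D = family_sum x ?S"
    by (rule M.add.gfinprod_mono_neutral_cong_right) (use car in auto)
  moreover have "gfinprod (add_monoid (sub_mod M N)) x ?S = family_sum x ?S"
    by (cases "finite ?S") (use fin[of ?S] in \<open>auto simp: gfinprod_def\<close>)
  ultimately show ?thesis by simp
qed

lemma carrier_sum_group_sub_mod:
  assumes "submodules D"
  shows "carrier (sum_group D (\<lambda>A. add_monoid (sub_mod M A))) = families D \<inter> extensional D"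
proof -
  have "group (add_monoid (sub_mod M A))" if "A \<in> D" for A
    using subgroup.subgroup_is_group[OF submodule.axioms(1) M.add.group_axioms, of A R] assms that
    by (simp add: submodules_def)
  then show ?thesis
    by (subst carrier_sum_group) (auto simp: families_def PiE_def)
qed

lemma families_restrict_domain:
  assumes D: "submodules D" and x: "x \<in> families D"
  shows "restrict x D \<in> families D \<inter> extensional D"
    and "family_sum (restrict x D) D = family_sum x D"
proof -
  have "{A \<in> D. restrict x D A \<noteq> \<zero>\<^bsub>M\<^esub>} = {A \<in> D. x A \<noteq> \<zero>\<^bsub>M\<^esub>}"
    by auto
  then show "restrict x D \<in> families D \<inter> extensional D"
    using x by (simp add: families_def)
  show "family_sum (restrict x D) D = family_sum x D"
    using families_carrier[OF D x]
    by (intro M.add.gfinprod_cong[where B = D and g = x]) (auto simp: simp_implies_def)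
qed

lemma inj_on_family_sum_iff:
  assumes D: "submodules D"
  shows "inj_on (\<lambda>x. family_sum x D) (families D \<inter> extensional D) \<longleftrightarrow>
    (\<forall>x\<in>families D. family_sum x D = \<zero>\<^bsub>M\<^esub> \<longrightarrow> (\<forall>A\<in>D. x A = \<zero>\<^bsub>M\<^esub>))"
  (is "?inj \<longleftrightarrow> ?ker")
proof
  assume inj: ?inj
  show ?ker
  proof (intro ballI impI)
    fix x A assume x: "x \<in> families D" and sum0: "family_sum x D = \<zero>\<^bsub>M\<^esub>" and A: "A \<in> D"
    note z = families_zero[OF D]
    have "restrict x D = restrict (\<lambda>_. \<zero>\<^bsub>M\<^esub>) D"
    proof (rule inj_onD[OF inj])
      show "family_sum (restrict x D) D = family_sum (restrict (\<lambda>_. \<zero>\<^bsub>M\<^esub>) D) D"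
        unfolding families_restrict_domain(2)[OF D x] families_restrict_domain(2)[OF D z]
          sum0 family_sum_zero ..
    qed (rule families_restrict_domain(1)[OF D x] families_restrict_domain(1)[OF D z])+
    from fun_cong[OF this, of A] A show "x A = \<zero>\<^bsub>M\<^esub>" by simp
  qed
next
  assume ker: ?ker
  show ?inj
  proof (rule inj_onI)
    fix x y
    assume x: "x \<in> families D \<inter> extensional D" and y: "y \<in> families D \<inter> extensional D"
      and eq: "family_sum x D = family_sum y D"
    have x': "x \<in> families D" and y': "y \<in> families D"
      using x y by auto
    note my = families_minus[OF D y']
    let ?d = "\<lambda>A. x A \<oplus>\<^bsub>M\<^esub> \<ominus>\<^bsub>M\<^esub> y A"
    have car: "x A \<in> carrier M" "y A \<in> carrier M" if "A \<in> D" for A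
      using that families_carrier[OF D x'] families_carrier[OF D y'] by auto
    have "family_sum y D \<in> carrier M"
      by (rule M.add.gfinprod_closed[OF families_carrier[OF D y']])
    then have "family_sum ?d D = \<zero>\<^bsub>M\<^esub>"
      unfolding families_add(2)[OF D x' my(1)] my(2) eq by (rule M.r_neg)
    then have d: "?d A = \<zero>\<^bsub>M\<^esub>" if "A \<in> D" for A
      using ker families_add(1)[OF D x' my(1)] that by blast
    have "x A = y A" if "A \<in> D" for A
      using d[OF that] car[OF that] M.minus_equality[of "x A" "\<ominus>\<^bsub>M\<^esub> y A"] by simp
    then show "x = y"
      using x y by (auto intro: extensionalityI)
  qed
qed

lemma image_family_sum_extensional:
  assumes D: "submodules D"
  shows "(\<lambda>x. family_sum x D) ` (families D \<inter> extensional D) = span D"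
proof
  show "span D \<subseteq> (\<lambda>x. family_sum x D) ` (families D \<inter> extensional D)"
  proof
    fix a assume "a \<in> span D"
    then obtain x where x: "x \<in> families D" and a: "a = family_sum x D"
      by (rule spanE)
    show "a \<in> (\<lambda>x. family_sum x D) ` (families D \<inter> extensional D)"
      unfolding a families_restrict_domain(2)[OF D x, symmetric]
      by (rule imageI[OF families_restrict_domain(1)[OF D x]])
  qed
qed (auto simp: span_def)

text \<open>
  This moves all reasoning about decompositions of submodules into the ambient module \<open>M\<close>. Members of
  an independent \<open>D\<close> lie in its span, so \<open>span D = N\<close> already forces them to be submodules of \<open>N\<close>.
\<close>

lemma decomposition_iff:
  assumes N: "submodule N R M"
  shows "direct_sum_decomposition R (sub_mod M N) D \<longleftrightarrow> independent D \<and> span D = N"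
proof (cases "\<forall>A\<in>D. submodule A R M \<and> A \<subseteq> N \<and> A \<noteq> {\<zero>\<^bsub>M\<^esub>}")
  case True
  then have D: "submodules D" by (simp add: submodules_def)
  let ?F = "families D \<inter> extensional D"
  have "x \<in> D \<rightarrow> N" if "x \<in> ?F" for x
    using that True by (auto simp: families_def)
  then have "bij_betw (\<lambda>x. gfinprod (add_monoid (sub_mod M N)) x D) ?F N
      \<longleftrightarrow> bij_betw (\<lambda>x. family_sum x D) ?F N"
    by (intro bij_betw_cong gfinprod_sub_mod[OF N])
  also have "\<dots> \<longleftrightarrow> independent D \<and> span D = N"
    using True unfolding bij_betw_def inj_on_family_sum_iff[OF D] image_family_sum_extensional[OF D]
      independent_def by blast
  moreover have "direct_sum_decomposition R (sub_mod M N) D \<longleftrightarrow>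
      bij_betw (\<lambda>x. gfinprod (add_monoid (sub_mod M N)) x D) ?F N"
    using True carrier_sum_group_sub_mod[OF D]
    by (simp add: direct_sum_decomposition_def submodule_sub_mod_iff[OF N])
  ultimately show ?thesis by simp
next
  case False
  then have "\<not> direct_sum_decomposition R (sub_mod M N) D"
    unfolding direct_sum_decomposition_def submodule_sub_mod_iff[OF N] by simp
  moreover have "submodule A R M \<and> A \<subseteq> N \<and> A \<noteq> {\<zero>\<^bsub>M\<^esub>}"
    if D: "independent D" and "span D = N" and A: "A \<in> D" for A
    using D A mem_subset_span[OF independent_imp_submodules[OF D] A] \<open>span D = N\<close>
    by (simp add: independent_def)
  ultimately show ?thesis using False by blast
qed

lemma indecomposable_iff:
  assumes A: "submodule A R M"
  shows "indecomposable_module R (sub_mod M A) \<longleftrightarrow>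
    A \<noteq> {\<zero>\<^bsub>M\<^esub>} \<and>
    (\<forall>B C. submodule B R M \<and> submodule C R M \<and> B \<inter> C = {\<zero>\<^bsub>M\<^esub>} \<and> B <+>\<^bsub>M\<^esub> C = A
      \<longrightarrow> B = {\<zero>\<^bsub>M\<^esub>} \<or> C = {\<zero>\<^bsub>M\<^esub>})"
proof -
  have "submodule B R (sub_mod M A) \<and> submodule C R (sub_mod M A) \<and> B \<inter> C = {\<zero>\<^bsub>M\<^esub>} \<and> B <+>\<^bsub>M\<^esub> C = A
      \<longleftrightarrow> submodule B R M \<and> submodule C R M \<and> B \<inter> C = {\<zero>\<^bsub>M\<^esub>} \<and> B <+>\<^bsub>M\<^esub> C = A" for B C
    unfolding submodule_sub_mod_iff[OF A] using set_add_upper[of B C] by fast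
  then show ?thesis
    by (simp add: indecomposable_module_def set_add_sub_mod)
qed

section \<open>The Krull-Schmidt length\<close>

definition KSl :: "'b set \<Rightarrow> enat"
  where "KSl N = KS_length R (sub_mod M N)"

lemma KSl_carrier: "KSl (carrier M) = KS_length R M"
  by (simp add: KSl_def)

lemma KSl_eq_SUP:
  assumes "submodule N R M"
  shows "KSl N = (SUP D \<in> {D. independent D \<and> span D = N}. ecard D)"
  by (simp add: KSl_def KS_length_def decomposition_iff[OF assms])

lemma ecard_le_KSl:
  assumes "independent D"
  shows "ecard D \<le> KSl (span D)"
  unfolding KSl_eq_SUP[OF submodule_span[OF independent_imp_submodules[OF assms]]]
  by (rule SUP_upper) (use assms in simp)

lemma ex_decomposition:
  assumes "submodule N R M"
  shows "\<exists>D. independent D \<and> span D = N"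
proof (cases "N = {\<zero>\<^bsub>M\<^esub>}")
  case True
  then show ?thesis
    using independent_empty span_empty by blast
next
  case False
  then show ?thesis
    using independent_singleton[OF assms] span_singleton[OF assms] by blast
qed

text \<open>
  A finite supremum of a nonempty set of extended natural numbers is a maximum.
\<close>

lemma KSl_attained:
  assumes N: "submodule N R M" and fin: "KSl N < \<infinity>"
  obtains D where "independent D" and "span D = N" and "ecard D = KSl N"
proof -
  let ?S = "ecard ` {D. independent D \<and> span D = N}"
  have ne: "?S \<noteq> {}"
    using ex_decomposition[OF N] by blast
  have S: "Sup ?S = KSl N"
    by (rule KSl_eq_SUP[OF N, symmetric])
  have "Sup ?S \<in> ?S"
    by (rule Sup_enat_attained[OF ne]) (unfold S, rule fin)
  then obtain D where "KSl N = ecard D" and "D \<in> {D. independent D \<and> span D = N}"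
    unfolding S by (rule imageE)
  then show thesis
    using that[of D] by simp
qed

lemma ecard_independent_Un:
  assumes "independent D" and "independent E" and "span D \<inter> span E = {\<zero>\<^bsub>M\<^esub>}"
  shows "ecard (D \<union> E) = ecard D + ecard E"
  by (rule ecard_Un_disjoint[OF independent_Un(1)[OF assms]])

text \<open>
  For decompositions \<open>D\<close> of \<open>A\<close> and \<open>E\<close> of \<open>B\<close>, the union \<open>D \<union> E\<close> decomposes \<open>A \<oplus> B\<close>. If the
  length of \<open>A \<oplus> B\<close> is finite, it bounds the lengths of \<open>A\<close> and \<open>B\<close>, so that \<open>D\<close> and \<open>E\<close> can be
  chosen to attain them.
\<close>

lemma KSl_superadditive:
  assumes A: "submodule A R M" and B: "submodule B R M" and AB: "A \<inter> B = {\<zero>\<^bsub>M\<^esub>}"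
  shows "KSl A + KSl B \<le> KSl (A <+>\<^bsub>M\<^esub> B)"
proof (cases "KSl (A <+>\<^bsub>M\<^esub> B) = \<infinity>")
  case False
  have le: "ecard D + ecard E \<le> KSl (A <+>\<^bsub>M\<^esub> B)"
    if "independent D" "span D = A" "independent E" "span E = B" for D E
  proof -
    have int: "span D \<inter> span E = {\<zero>\<^bsub>M\<^esub>}"
      using that AB by simp
    have "ecard (D \<union> E) \<le> KSl (span (D \<union> E))"
      by (rule ecard_le_KSl[OF independent_Un(2)[OF that(1,3) int]])
    then show ?thesis
      by (simp only: ecard_independent_Un[OF that(1,3) int] independent_Un(3)[OF that(1,3) int] that(2,4))
  qed
  obtain D E where D: "independent D" "span D = A" and E: "independent E" "span E = B"
    using ex_decomposition[OF A] ex_decomposition[OF B] by blast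
  have "ecard D' \<le> KSl (A <+>\<^bsub>M\<^esub> B)" if "independent D'" "span D' = A" for D'
    by (rule order_trans[OF _ le[OF that E]]) simp
  then have leA: "KSl A \<le> KSl (A <+>\<^bsub>M\<^esub> B)"
    unfolding KSl_eq_SUP[OF A] by (intro SUP_least) simp
  have "ecard E' \<le> KSl (A <+>\<^bsub>M\<^esub> B)" if "independent E'" "span E' = B" for E'
    by (rule order_trans[OF _ le[OF D that]]) simp
  then have leB: "KSl B \<le> KSl (A <+>\<^bsub>M\<^esub> B)"
    unfolding KSl_eq_SUP[OF B] by (intro SUP_least) simp
  have fin: "KSl (A <+>\<^bsub>M\<^esub> B) < \<infinity>"
    using False by simp
  note finA = order.strict_trans1[OF leA fin] and finB = order.strict_trans1[OF leB fin]
  obtain D0 where D0: "independent D0" "span D0 = A" "ecard D0 = KSl A"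
    by (rule KSl_attained[OF A finA])
  obtain E0 where E0: "independent E0" "span E0 = B" "ecard E0 = KSl B"
    by (rule KSl_attained[OF B finB])
  show ?thesis
    using le[OF D0(1,2) E0(1,2)] unfolding D0(3) E0(3) .
qed simp

lemma KSl_summand_le:
  assumes "N \<in> direct_summands R M"
  shows "KSl N \<le> KS_length R M"
proof -
  obtain N' where "submodule N R M" "submodule N' R M" "N \<inter> N' = {\<zero>\<^bsub>M\<^esub>}" "N <+>\<^bsub>M\<^esub> N' = carrier M"
    using assms by (auto simp: direct_summands_def)
  then have "KSl N + KSl N' \<le> KS_length R M"
    using KSl_superadditive[of N N'] unfolding KSl_carrier[symmetric] by simp
  then show ?thesis
    by (rule order_trans[rotated]) simp
qed

lemma KSl_zero: "KSl {\<zero>\<^bsub>M\<^esub>} = 0"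
proof -
  have "ecard D \<le> 0" if D: "independent D" and sp: "span D = {\<zero>\<^bsub>M\<^esub>}" for D
  proof -
    have "A = {\<zero>\<^bsub>M\<^esub>}" if A: "A \<in> D" for A
    proof -
      have "A \<subseteq> {\<zero>\<^bsub>M\<^esub>}"
        using mem_subset_span[OF independent_imp_submodules[OF D] A] unfolding sp .
      moreover have "\<zero>\<^bsub>M\<^esub> \<in> A"
        using D A by (intro submoduleD(2)) (simp add: independent_def)
      ultimately show ?thesis by blast
    qed
    then have "D = {}"
      using D unfolding independent_def by blast
    then show ?thesis
      by (simp add: ecard_eq_0_iff)
  qed
  then have "KSl {\<zero>\<^bsub>M\<^esub>} \<le> 0"
    unfolding KSl_eq_SUP[OF submodule_zero] by (intro SUP_least) blast
  then show ?thesis by simp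
qed

lemma KSl_ge_1:
  assumes "submodule A R M" and "A \<noteq> {\<zero>\<^bsub>M\<^esub>}"
  shows "1 \<le> KSl A"
  using ecard_le_KSl[OF independent_singleton[OF assms]] span_singleton[OF assms(1)]
  by (simp add: ecard_def one_enat_def)

text \<open>
  If \<open>B\<close> is a summand in a decomposition \<open>D\<close> of an indecomposable module, the other summands span a
  complement of \<open>B\<close>, which must be zero. Its length is then zero, so there are no other summands.
\<close>

lemma KSl_indecomposable_le_1:
  assumes A: "submodule A R M" and ind: "indecomposable_module R (sub_mod M A)"
  shows "KSl A \<le> 1"
proof -
  have "ecard D \<le> 1" if D: "independent D" and sp: "span D = A" for D
  proof (cases "D = {}")
    case True
    then have "ecard D = 0"
      by (simp add: ecard_eq_0_iff)
    then show ?thesis by simp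
  next
    case False
    then obtain B where B: "B \<in> D" by blast
    note rem = independent_remove[OF D B]
    have sub: "submodule B R M" "B \<noteq> {\<zero>\<^bsub>M\<^esub>}"
      using D B unfolding independent_def by blast+
    have "span (D - {B}) = {\<zero>\<^bsub>M\<^esub>}"
      using ind sub rem(2,3) sp submodule_span[OF independent_imp_submodules[OF rem(1)]]
      unfolding indecomposable_iff[OF A] by blast
    then have "ecard (D - {B}) = 0"
      using ecard_le_KSl[OF rem(1)] KSl_zero by simp
    then have "D = {B}"
      using B unfolding ecard_eq_0_iff by blast
    then show ?thesis
      by (simp add: ecard_def one_enat_def)
  qed
  then show ?thesis
    unfolding KSl_eq_SUP[OF A] by (intro SUP_least) blast
qed

text \<open>
  By superadditivity, \<open>\<ell>(A)\<close> plus the number of the other summands is at most the cardinality of \<open>D\<close>,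
  so \<open>\<ell>(A) \<le> 1\<close>; a splitting of \<open>A\<close> into two nonzero summands would make \<open>\<ell>(A)\<close> at least 2.
\<close>

lemma maximal_decomposition_indecomposable:
  assumes D: "independent D" and max: "ecard D = KSl (span D)" and fin: "KSl (span D) < \<infinity>"
    and A: "A \<in> D"
  shows "indecomposable_module R (sub_mod M A)"
proof -
  note rem = independent_remove[OF D A]
  have sA: "submodule A R M" "A \<noteq> {\<zero>\<^bsub>M\<^esub>}"
    using D A by (auto simp: independent_def)
  have sR: "submodule (span (D - {A})) R M"
    by (rule submodule_span[OF independent_imp_submodules[OF rem(1)]])
  have "ecard D = 1 + ecard (D - {A})"
    using ecard_Un_disjoint[of "{A}" "D - {A}"] A by (simp add: insert_absorb ecard_def one_enat_def)
  moreover have "KSl A + ecard (D - {A}) \<le> ecard D"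
  proof -
    have "KSl A + ecard (D - {A}) \<le> KSl A + KSl (span (D - {A}))"
      by (rule add_left_mono[OF ecard_le_KSl[OF rem(1)]])
    also have "\<dots> \<le> ecard D"
      using KSl_superadditive[OF sA(1) sR rem(2)] unfolding rem(3) max .
    finally show ?thesis .
  qed
  ultimately have "KSl A + ecard (D - {A}) \<le> 1 + ecard (D - {A})"
    by simp
  moreover have "ecard (D - {A}) < \<infinity>"
    using max fin by (auto simp: ecard_def split: if_splits)
  ultimately have le1: "KSl A \<le> 1"
    by (cases "KSl A"; cases "ecard (D - {A})") (auto simp: one_enat_def)
  have "B = {\<zero>\<^bsub>M\<^esub>} \<or> C = {\<zero>\<^bsub>M\<^esub>}"
    if "submodule B R M" "submodule C R M" "B \<inter> C = {\<zero>\<^bsub>M\<^esub>}" "B <+>\<^bsub>M\<^esub> C = A" for B C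
  proof (rule ccontr)
    assume "\<not> ?thesis"
    then have "1 + 1 \<le> KSl B + KSl C"
      using KSl_ge_1 that by (intro add_mono) auto
    also have "\<dots> \<le> 1"
      using KSl_superadditive[OF that(1-3)] that(4) le1 by simp
    finally show False by (simp add: one_enat_def)
  qed
  then show ?thesis
    unfolding indecomposable_iff[OF sA(1)] using sA(2) by blast
qed

lemma indecomposable_decomposition_iff:
  assumes "submodule N R M"
  shows "indecomposable_decomposition R (sub_mod M N) D \<longleftrightarrow>
    independent D \<and> span D = N \<and> (\<forall>A\<in>D. indecomposable_module R (sub_mod M A))"
  by (auto simp: indecomposable_decomposition_def decomposition_iff[OF assms])

lemma obtain_maximal_indecomposable_decomposition:
  assumes N: "submodule N R M" and fin: "KSl N < \<infinity>"
  obtains D where "indecomposable_decomposition R (sub_mod M N) D" and "ecard D = KSl N"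
proof -
  obtain D where "independent D" "span D = N" "ecard D = KSl N"
    using KSl_attained[OF N fin] .
  then show thesis
    using that maximal_decomposition_indecomposable[of D] fin
    by (auto simp: indecomposable_decomposition_iff[OF N])
qed

lemma indecomposable_decomposition_Un:
  assumes A: "submodule A R M" and B: "submodule B R M" and AB: "A \<inter> B = {\<zero>\<^bsub>M\<^esub>}"
    and D: "indecomposable_decomposition R (sub_mod M A) D"
    and E: "indecomposable_decomposition R (sub_mod M B) E"
  shows "indecomposable_decomposition R (sub_mod M (A <+>\<^bsub>M\<^esub> B)) (D \<union> E)"
    and "ecard (D \<union> E) = ecard D + ecard E"
  using D E AB independent_Un[of D E] ecard_independent_Un[of D E]
  by (auto simp: indecomposable_decomposition_iff A B submodule_set_add)

section \<open>Rank functions and unique cardinalities\<close>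

text \<open>
  The induction removes one summand \<open>A\<close> of \<open>N\<close> at a time. It runs over all direct summands \<open>N\<close> of
  \<open>M\<close>, because the remaining summands decompose a complement of \<open>A\<close> in \<open>N\<close>; this complement and \<open>A\<close>
  are again direct summands of \<open>M\<close>, as subadditivity requires.
\<close>

lemma KSl_le_ecard_if_rank_function:
  assumes rank: "rank_function R M KSl"
    and "N \<in> direct_summands R M" and "indecomposable_decomposition R (sub_mod M N) D" and "finite D"
  shows "KSl N \<le> ecard D"
  using assms(4,2,3)
proof (induction D arbitrary: N rule: finite_induct)
  case empty
  then have "N = {\<zero>\<^bsub>M\<^esub>}"
    by (auto simp: direct_summands_def indecomposable_decomposition_iff span_empty)
  then show ?case by (simp add: KSl_zero)
next
  case (insert A D)
  have N: "submodule N R M"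
    using insert.prems by (auto simp: direct_summands_def)
  have D: "independent (insert A D)" "span (insert A D) = N"
    and ind: "\<forall>B\<in>insert A D. indecomposable_module R (sub_mod M B)"
    using insert.prems(2) by (auto simp: indecomposable_decomposition_iff[OF N])
  have rem: "independent D" "A \<inter> span D = {\<zero>\<^bsub>M\<^esub>}" "A <+>\<^bsub>M\<^esub> span D = N"
    using independent_remove[OF D(1), of A] insert.hyps D(2) by auto
  have A: "submodule A R M" and S: "submodule (span D) R M"
    using D(1) submodule_span[OF independent_imp_submodules[OF rem(1)]] by (auto simp: independent_def)
  have comm: "span D <+>\<^bsub>M\<^esub> A = N"
    using rem(3) unfolding set_add_comm[OF S A] .
  have sA: "A \<in> direct_summands R M"
    by (rule direct_summands_trans[OF insert.prems(1) A S rem(2,3)])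
  have sS: "span D \<in> direct_summands R M"
    using direct_summands_trans[OF insert.prems(1) S A _ comm] rem(2) by auto
  have "KSl N \<le> KSl A + KSl (span D)"
    using rank sA sS rem(2,3) insert.prems(1) unfolding rank_function_def by blast
  also have "\<dots> \<le> 1 + ecard D"
  proof (rule add_mono)
    show "KSl A \<le> 1"
      using KSl_indecomposable_le_1[OF A] ind by blast
    show "KSl (span D) \<le> ecard D"
      using insert.IH[OF sS] rem(1) ind by (simp add: indecomposable_decomposition_iff[OF S])
  qed
  also have "\<dots> = ecard (insert A D)"
    using insert.hyps by (simp add: ecard_def one_enat_def)
  finally show ?case .
qed

text \<open>
  Both \<open>D\<close> and a decomposition \<open>D0\<close> of \<open>N\<close> that attains the length are extended by one and the same
  decomposition \<open>E\<close> of a complement of \<open>N\<close>. The cardinality of \<open>E\<close> can be cancelled because it is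
  finite.
\<close>

lemma KSl_eq_ecard_if_unique_cardinality:
  assumes fin: "KS_length R M < \<infinity>"
    and unique: "\<And>D D'. \<lbrakk>indecomposable_decomposition R M D; indecomposable_decomposition R M D'\<rbrakk> \<Longrightarrow> D \<approx> D'"
    and N: "N \<in> direct_summands R M" and D: "indecomposable_decomposition R (sub_mod M N) D"
  shows "KSl N = ecard D"
proof -
  obtain N' where sN: "submodule N R M" and sN': "submodule N' R M"
    and NN': "N \<inter> N' = {\<zero>\<^bsub>M\<^esub>}" "N <+>\<^bsub>M\<^esub> N' = carrier M"
    using N by (auto simp: direct_summands_def)
  have "KSl N < \<infinity>"
    using KSl_summand_le[OF N] fin by (rule order.strict_trans1)
  then obtain D0 where D0: "indecomposable_decomposition R (sub_mod M N) D0" "ecard D0 = KSl N"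
    using obtain_maximal_indecomposable_decomposition[OF sN] by blast
  have "N' <+>\<^bsub>M\<^esub> N = carrier M"
    using NN'(2) unfolding set_add_comm[OF sN' sN] .
  then have "N' \<in> direct_summands R M"
    using sN sN' NN'(1) by (auto simp: direct_summands_def)
  then have "KSl N' < \<infinity>"
    using KSl_summand_le[of N'] fin by (metis order.strict_trans1)
  then obtain E where E: "indecomposable_decomposition R (sub_mod M N') E" "ecard E = KSl N'"
    using obtain_maximal_indecomposable_decomposition[OF sN'] by blast
  note un = indecomposable_decomposition_Un[OF sN sN' NN'(1) _ E(1)]
  have "D \<union> E \<approx> D0 \<union> E"
    using un(1)[OF D] un(1)[OF D0(1)] unique NN'(2) by simp
  then have "ecard (D \<union> E) = ecard (D0 \<union> E)"
    by (metis ecard_def bij_betw_same_card eqpoll_def eqpoll_finite_iff)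
  then have "ecard D + KSl N' = ecard D0 + KSl N'"
    using un(2)[OF D] un(2)[OF D0(1)] E(2) by simp
  then have "ecard D = ecard D0"
    using \<open>KSl N' < \<infinity>\<close> by (cases "ecard D"; cases "ecard D0"; cases "KSl N'") auto
  then show ?thesis
    using D0(2) by simp
qed

lemma additive_function_if_unique_cardinality:
  assumes fin: "KS_length R M < \<infinity>"
    and unique: "\<And>D D'. \<lbrakk>indecomposable_decomposition R M D; indecomposable_decomposition R M D'\<rbrakk> \<Longrightarrow> D \<approx> D'"
  shows "additive_function R M KSl"
proof -
  have finite_summand: "KSl A < \<infinity>" if "A \<in> direct_summands R M" for A
    using KSl_summand_le[OF that] fin by (rule order.strict_trans1)
  have "KSl (A <+>\<^bsub>M\<^esub> B) = KSl A + KSl B"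
    if A: "A \<in> direct_summands R M" and B: "B \<in> direct_summands R M"
      and AB: "A \<inter> B = {\<zero>\<^bsub>M\<^esub>}" and sum: "A <+>\<^bsub>M\<^esub> B \<in> direct_summands R M" for A B
  proof -
    have sA: "submodule A R M" and sB: "submodule B R M"
      using A B by (auto simp: direct_summands_def)
    obtain D where D: "indecomposable_decomposition R (sub_mod M A) D" "ecard D = KSl A"
      using obtain_maximal_indecomposable_decomposition[OF sA finite_summand[OF A]] .
    obtain E where E: "indecomposable_decomposition R (sub_mod M B) E" "ecard E = KSl B"
      using obtain_maximal_indecomposable_decomposition[OF sB finite_summand[OF B]] .
    note un = indecomposable_decomposition_Un[OF sA sB AB D(1) E(1)]
    show ?thesis
      using KSl_eq_ecard_if_unique_cardinality[OF fin unique sum un(1)] un(2) D(2) E(2) by simp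
  qed
  moreover have "KSl \<in> direct_summands R M \<rightarrow> range enat"
    using finite_summand by (metis Pi_I less_infinityE rangeI)
  ultimately show ?thesis
    unfolding additive_function_def by blast
qed

text \<open>
  A rank function is subadditive by definition; \<open>KSl_superadditive\<close> is the other inequality.
\<close>

lemma rank_function_iff_additive_function: "rank_function R M KSl \<longleftrightarrow> additive_function R M KSl"
proof
  assume rank: "rank_function R M KSl"
  have "KSl (A <+>\<^bsub>M\<^esub> B) = KSl A + KSl B"
    if "A \<in> direct_summands R M" "B \<in> direct_summands R M" "A \<inter> B = {\<zero>\<^bsub>M\<^esub>}"
      "A <+>\<^bsub>M\<^esub> B \<in> direct_summands R M" for A B
  proof (rule antisym)
    show "KSl (A <+>\<^bsub>M\<^esub> B) \<le> KSl A + KSl B"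
      using rank that unfolding rank_function_def by blast
    show "KSl A + KSl B \<le> KSl (A <+>\<^bsub>M\<^esub> B)"
      using that by (intro KSl_superadditive) (auto simp: direct_summands_def)
  qed
  then show "additive_function R M KSl"
    using rank unfolding rank_function_def additive_function_def by blast
next
  assume "additive_function R M KSl"
  then show "rank_function R M KSl"
    unfolding rank_function_def additive_function_def by auto
qed

text \<open>
  Every indecomposable decomposition of \<open>M\<close> has cardinality \<open>\<ell>(M)\<close>: at most, as \<open>\<ell>(M)\<close> is a
  supremum over all decompositions, and at least, by the rank property.
\<close>

lemma unique_cardinality_if_rank_function:
  assumes fin: "KS_length R M < \<infinity>" and rank: "rank_function R M KSl"
    and D: "indecomposable_decomposition R M D" and D': "indecomposable_decomposition R M D'"
  shows "D \<approx> D'"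
proof -
  have M: "carrier M \<in> direct_summands R M"
    using submodule_carrier submodule_zero
    by (auto simp: direct_summands_def set_add_mem_iff intro!: exI[of _ "{\<zero>\<^bsub>M\<^esub>}"])
  have "finite E \<and> enat (card E) = KS_length R M" if E: "indecomposable_decomposition R M E" for E
  proof -
    have E': "indecomposable_decomposition R (sub_mod M (carrier M)) E"
      using E by simp
    then have "independent E" and span: "span E = carrier M"
      unfolding indecomposable_decomposition_iff[OF submodule_carrier] by blast+
    from ecard_le_KSl[OF this(1)] have "ecard E \<le> KS_length R M"
      unfolding span KSl_carrier .
    moreover from this have "finite E"
      using fin by (auto simp: ecard_def split: if_splits)
    moreover from this have "KS_length R M \<le> ecard E"
      using KSl_le_ecard_if_rank_function[OF rank M E'] KSl_carrier by simp
    ultimately show ?thesis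
      by (simp add: ecard_def)
  qed
  from this[OF D] this[OF D'] show ?thesis
    by (metis enat.inject eqpoll_iff_card)
qed

end

theorem theorem5p4:
  fixes R :: "('a, 'r) ring_scheme" and M :: "('a, 'b, 'm) module_scheme"
  assumes "left_module R M"
    and "KS_length R M < \<infinity>"
  shows
    "((\<forall>D D'. indecomposable_decomposition R M D \<and> indecomposable_decomposition R M D'
          \<longrightarrow> D \<approx> D')
        \<longleftrightarrow> rank_function R M (\<lambda>N. KS_length R (sub_mod M N)))
     \<and> (rank_function R M (\<lambda>N. KS_length R (sub_mod M N))
        \<longleftrightarrow> additive_function R M (\<lambda>N. KS_length R (sub_mod M N)))
     \<and> ((\<forall>D D'. indecomposable_decomposition R M D \<and> indecomposable_decomposition R M D'
          \<longrightarrow> D \<approx> D')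
        \<longrightarrow> (\<forall>N \<in> direct_summands R M. \<forall>D. indecomposable_decomposition R (sub_mod M N) D
              \<longrightarrow> KS_length R (sub_mod M N) = ecard D))"
proof -
  interpret left_module R M by fact
  have KSl: "(\<lambda>N. KS_length R (sub_mod M N)) = KSl"
    by (simp add: KSl_def fun_eq_iff)
  note fin = assms(2)
  show ?thesis
    unfolding KSl
  proof (intro conjI iffI allI impI ballI)
    assume "\<forall>D D'. indecomposable_decomposition R M D \<and> indecomposable_decomposition R M D' \<longrightarrow> D \<approx> D'"
    then show "rank_function R M KSl"
      unfolding rank_function_iff_additive_function
      by (intro additive_function_if_unique_cardinality[OF fin]) blast
  next
    fix D D'
    assume "rank_function R M KSl"
      and "indecomposable_decomposition R M D \<and> indecomposable_decomposition R M D'"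
    then show "D \<approx> D'"
      using unique_cardinality_if_rank_function[OF fin] by blast
  next
    fix N D
    assume "\<forall>D D'. indecomposable_decomposition R M D \<and> indecomposable_decomposition R M D' \<longrightarrow> D \<approx> D'"
      and "N \<in> direct_summands R M" and "indecomposable_decomposition R (sub_mod M N) D"
    then show "KS_length R (sub_mod M N) = ecard D"
      using KSl_eq_ecard_if_unique_cardinality[OF fin, of N D] by (simp add: KSl_def)
  qed (simp_all add: rank_function_iff_additive_function)
qed

end
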